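(* Let $n\geq 1$. The following linear maps are algebra morphisms: $$\zeta:(K\mathcal{E}_n,\lhd)\longrightarrow(K\mathfrak{S}_n,\circ),\quad P_w\longmapsto\sum_{\sigma\in Comp(w)}\sigma^{-1},\qquad \zeta':(K\mathfrak{S}_n,\circ)\longrightarrow(K\mathcal{E}_n,\lhd),\quad \sigma\longmapsto P_{\sigma^{-1}}.$$ Moreover, $\zeta\circ\zeta'=Id_{K\mathfrak{S}_n}$.
   Context: Fix an arbitrary field $K$. For a preorder $\leq_a$, write $i\sim_a j$ if $i\leq_a j$ and $j\leq_a i$, and $i<_a j$ if $i\leq_a j$ and not $i\sim_a j$. A double quasi-poset is a triple $P=(V(P),\leq_1,\leq_2)$ with $V(P)$ a finite set and $\leq_1,\leq_2$ two preorders on $V(P)$. An isomorphism is a bijection preserving and reflecting both preorders. $\mathcal{H}_{\mathbf{dqp}}$ is the $K$-vector space with basis the set of isomorphism classes of double quasi-posets. For a bijection $f:V(P)\to V(Q)$, $P\times_f Q=(V(P),\leq_1^f,\leq_2)$, where $i\leq_1^f j$ iff $f(i)\leq_1 f(j)$ in $Q$, and $\leq_2$ is the second preorder of $P$. $I_<(P,Q)$ is the set of bijections $f:V(P)\to V(Q)$ such that $i<_1 j\Rightarrow f(i)<_2 f(j)$ for all $i,j$. The associative product $\lhd$ on $\mathcal{H}_{\mathbf{dqp}}$ is the bilinear extension of $P\lhd Q=\sum_{f\in I_<(P,Q)}P\times_f Q$. A packed word of length $n$ is a word $w=w_1\dots w_n$ over the positive integers whose set of letters is $\{1,\dots,r\}$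 for some $r$; it is identified with the surjection $[n]\to[r]$, $i\mapsto w_i$. $\mathcal{E}_n$ is the set of packed words of length $n$; permutations in $\mathfrak{S}_n$ are those with $n$ distinct letters. To $w\in\mathcal{E}_n$ one associates the double quasi-poset $P_w$ with $V(P_w)=\{1,\dots,n\}$, $i\leq_1 j$ iff $w_i\leq w_j$, and $\leq_2$ the usual order on $\{1,\dots,n\}$. The map $w\mapsto P_w$ is injective, and $K\mathcal{E}_n$ is identified with the subspace of $\mathcal{H}_{\mathbf{dqp}}$ spanned by the $P_w$, $w\in\mathcal{E}_n$, which is stable under $\lhd$. $Comp(w)$ is the set of $\sigma\in\mathfrak{S}_n$ such that for all $i,j\in\{1,\dots,n\}$, $w_i<w_j\Rightarrow\sigma(i)<\sigma(j)$. $(K\mathfrak{S}_n,\circ)$ is the group algebra with product extending composition, $(\sigma\circ\tau)(i)=\sigma(\tau(i))$. "Algebra" means associative algebra, not necessarily unital; "algebra morphism" means a multiplicative linear map. *)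

theory Defs
  imports
    Complex_Main
    "HOL-Library.Poly_Mapping"
    "HOL-Library.FuncSet"
    "HOL-Combinatorics.Permutations"
begin

section \<open>Free vector spaces\<close>

text \<open>
  The vector space over a field \<open>'k\<close> with basis a type \<open>'b\<close> is the type \<open>'b \<Rightarrow>\<^sub>0 'k\<close> of finitely
  supported functions; the basis vector of \<open>b\<close> is \<open>Poly_Mapping.single b 1\<close>. The multiplication
  that \<^theory>\<open>HOL-Library.Poly_Mapping\<close> puts on this type is not used.
\<close>

definition scale :: "'k::field \<Rightarrow> ('b \<Rightarrow>\<^sub>0 'k) \<Rightarrow> ('b \<Rightarrow>\<^sub>0 'k)" where
  "scale c x = Poly_Mapping.map ((*) c) x"

lemma lookup_scale [simp]: "Poly_Mapping.lookup (scale c x) b = c * Poly_Mapping.lookup x b"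
  unfolding scale_def by transfer (simp add: when_def)

global_interpretation free: vector_space scale
  defines free_span = free.span
  by unfold_locales (auto intro!: poly_mapping_eqI simp: lookup_add algebra_simps)

definition bilinear_ext ::
    "('a \<Rightarrow> 'b \<Rightarrow> ('c \<Rightarrow>\<^sub>0 'k::field)) \<Rightarrow> ('a \<Rightarrow>\<^sub>0 'k) \<Rightarrow> ('b \<Rightarrow>\<^sub>0 'k) \<Rightarrow> ('c \<Rightarrow>\<^sub>0 'k)" where
  "bilinear_ext g x y =
     (\<Sum>a\<in>Poly_Mapping.keys x. \<Sum>b\<in>Poly_Mapping.keys y.
        scale (Poly_Mapping.lookup x a * Poly_Mapping.lookup y b) (g a b))"

definition algebra_morphism_on ::
    "('a \<Rightarrow>\<^sub>0 'k::field) set \<Rightarrow> (('a \<Rightarrow>\<^sub>0 'k) \<Rightarrow> ('a \<Rightarrow>\<^sub>0 'k) \<Rightarrow> ('a \<Rightarrow>\<^sub>0 'k)) \<Rightarrow>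
     ('b \<Rightarrow>\<^sub>0 'k) set \<Rightarrow> (('b \<Rightarrow>\<^sub>0 'k) \<Rightarrow> ('b \<Rightarrow>\<^sub>0 'k) \<Rightarrow> ('b \<Rightarrow>\<^sub>0 'k)) \<Rightarrow>
     (('a \<Rightarrow>\<^sub>0 'k) \<Rightarrow> ('b \<Rightarrow>\<^sub>0 'k)) \<Rightarrow> bool" where
  "algebra_morphism_on A mulA B mulB f \<longleftrightarrow>
     f \<in> A \<rightarrow> B \<and>
     (\<forall>x\<in>A. \<forall>y\<in>A. f (x + y) = f x + f y) \<and>
     (\<forall>c. \<forall>x\<in>A. f (scale c x) = scale c (f x)) \<and>
     (\<forall>x\<in>A. \<forall>y\<in>A. mulA x y \<in> A \<and> f (mulA x y) = mulB (f x) (f y))"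


section \<open>Double quasi-posets\<close>

text \<open>
  Only isomorphism classes matter and every finite set is in bijection with a finite set of
  natural numbers, so the vertices are taken in \<^typ>\<open>nat\<close>.
\<close>

datatype dqp = DQP (verts: "nat set") (le1: "nat rel") (le2: "nat rel")

definition double_quasi_poset :: "dqp \<Rightarrow> bool" where
  "double_quasi_poset P \<longleftrightarrow>
     finite (verts P) \<and> preorder_on (verts P) (le1 P) \<and> preorder_on (verts P) (le2 P)"

definition equiv_rel :: "'a rel \<Rightarrow> 'a \<Rightarrow> 'a \<Rightarrow> bool" where
  "equiv_rel r i j \<longleftrightarrow> (i, j) \<in> r \<and> (j, i) \<in> r"

definition strict_rel :: "'a rel \<Rightarrow> 'a \<Rightarrow> 'a \<Rightarrow> bool" where
  "strict_rel r i j \<longleftrightarrow> (i, j) \<in> r \<and> \<not> equiv_rel r i j"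

definition dqp_iso :: "(nat \<Rightarrow> nat) \<Rightarrow> dqp \<Rightarrow> dqp \<Rightarrow> bool" where
  "dqp_iso \<alpha> P Q \<longleftrightarrow>
     bij_betw \<alpha> (verts P) (verts Q) \<and>
     (\<forall>i\<in>verts P. \<forall>j\<in>verts P. (i, j) \<in> le1 P \<longleftrightarrow> (\<alpha> i, \<alpha> j) \<in> le1 Q) \<and>
     (\<forall>i\<in>verts P. \<forall>j\<in>verts P. (i, j) \<in> le2 P \<longleftrightarrow> (\<alpha> i, \<alpha> j) \<in> le2 Q)"

definition dqp_isomorphic :: "dqp \<Rightarrow> dqp \<Rightarrow> bool" where
  "dqp_isomorphic P Q \<longleftrightarrow>
     double_quasi_poset P \<and> double_quasi_poset Q \<and> (\<exists>\<alpha>. dqp_iso \<alpha> P Q)"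

lemma dqp_iso_id: "dqp_iso id P P"
  by (simp add: dqp_iso_def)

lemma dqp_iso_inv:
  assumes "dqp_iso \<alpha> P Q"
  shows "dqp_iso (inv_into (verts P) \<alpha>) Q P"
proof -
  have b: "bij_betw \<alpha> (verts P) (verts Q)" using assms by (simp add: dqp_iso_def)
  have "inv_into (verts P) \<alpha> i \<in> verts P \<and> \<alpha> (inv_into (verts P) \<alpha> i) = i" if "i \<in> verts Q" for i
    using b that by (metis bij_betw_def f_inv_into_f inv_into_into)
  with assms b show ?thesis
    unfolding dqp_iso_def by (auto simp: bij_betw_inv_into)
qed

lemma dqp_iso_comp:
  assumes "dqp_iso \<alpha> P Q" "dqp_iso \<beta> Q R"
  shows "dqp_iso (\<beta> \<circ> \<alpha>) P R"
proof -
  have "\<alpha> i \<in> verts Q" if "i \<in> verts P" for i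
    using assms(1) that by (auto simp: dqp_iso_def bij_betw_def)
  with assms show ?thesis
    unfolding dqp_iso_def by (auto intro: bij_betw_trans)
qed

quotient_type dqp_class = dqp / partial: dqp_isomorphic
proof (rule part_equivpI)
  have "dqp_isomorphic (DQP {} {} {}) (DQP {} {} {})"
    using dqp_iso_id by (auto simp: dqp_isomorphic_def double_quasi_poset_def)
  then show "\<exists>P. dqp_isomorphic P P" by blast
  show "symp dqp_isomorphic"
    by (rule sympI) (auto simp: dqp_isomorphic_def dest: dqp_iso_inv)
  show "transp dqp_isomorphic"
    by (rule transpI) (auto simp: dqp_isomorphic_def dest: dqp_iso_comp)
qed

text \<open>The space \<open>\<H>\<^bsub>dqp\<^esub>\<close>.\<close>

type_synonym 'k hdqp = "dqp_class \<Rightarrow>\<^sub>0 'k"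

definition dqp_vec :: "dqp \<Rightarrow> 'k::field hdqp" where
  "dqp_vec P = Poly_Mapping.single (abs_dqp_class P) 1"

text \<open>\<open>twist P f Q\<close> is \<open>P \<times>\<^sub>f Q\<close>, used for bijections \<open>f\<close> only.\<close>

definition twist :: "dqp \<Rightarrow> (nat \<Rightarrow> nat) \<Rightarrow> dqp \<Rightarrow> dqp" where
  "twist P f Q =
     DQP (verts P) {(i, j) \<in> verts P \<times> verts P. (f i, f j) \<in> le1 Q} (le2 P)"

text \<open>
  Functions in \<open>I_less P Q\<close> are fixed outside \<^term>\<open>verts P\<close> (by extensionality), so that
  every bijection is counted exactly once.
\<close>

definition I_less :: "dqp \<Rightarrow> dqp \<Rightarrow> (nat \<Rightarrow> nat) set" where
  "I_less P Q =
     {f \<in> extensional (verts P). bij_betw f (verts P) (verts Q) \<and>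
        (\<forall>i\<in>verts P. \<forall>j\<in>verts P.
           strict_rel (le1 P) i j \<longrightarrow> strict_rel (le2 Q) (f i) (f j))}"

definition dqp_lhd :: "dqp \<Rightarrow> dqp \<Rightarrow> 'k::field hdqp" where
  "dqp_lhd P Q = (\<Sum>f\<in>I_less P Q. dqp_vec (twist P f Q))"

lemma double_quasi_poset_twist:
  assumes "double_quasi_poset P" "double_quasi_poset Q" "bij_betw f (verts P) (verts Q)"
  shows "double_quasi_poset (twist P f Q)"
proof -
  have f: "f i \<in> verts Q" if "i \<in> verts P" for i
    using assms(3) that by (auto simp: bij_betw_def)
  show ?thesis
    using assms(1,2) f
    unfolding double_quasi_poset_def twist_def preorder_on_def refl_on_def
    by (auto intro!: transI dest: transD)
qed

lemma strict_rel_iso: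
  assumes "dqp_iso \<alpha> P Q" "i \<in> verts P" "j \<in> verts P"
  shows "strict_rel (le1 P) i j \<longleftrightarrow> strict_rel (le1 Q) (\<alpha> i) (\<alpha> j)"
    and "strict_rel (le2 P) i j \<longleftrightarrow> strict_rel (le2 Q) (\<alpha> i) (\<alpha> j)"
  using assms by (auto simp: dqp_iso_def strict_rel_def equiv_rel_def)

definition conj_map :: "nat set \<Rightarrow> (nat \<Rightarrow> nat) \<Rightarrow> (nat \<Rightarrow> nat) \<Rightarrow> (nat \<Rightarrow> nat) \<Rightarrow> nat \<Rightarrow> nat" where
  "conj_map A \<alpha>' \<beta> f = restrict (\<beta> \<circ> f \<circ> \<alpha>') A"

lemma conj_map_I_less:
  assumes a: "dqp_iso \<alpha>' P' P" and b: "dqp_iso \<beta> Q Q'" and f: "f \<in> I_less P Q"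
  shows "conj_map (verts P') \<alpha>' \<beta> f \<in> I_less P' Q'"
proof -
  have ba: "bij_betw \<alpha>' (verts P') (verts P)" and bb: "bij_betw \<beta> (verts Q) (verts Q')"
    and bf: "bij_betw f (verts P) (verts Q)"
    using a b f by (auto simp: dqp_iso_def I_less_def)
  have am: "\<alpha>' i \<in> verts P" if "i \<in> verts P'" for i
    using ba that by (auto simp: bij_betw_def)
  have fm: "f i \<in> verts Q" if "i \<in> verts P" for i
    using bf that by (auto simp: bij_betw_def)
  have "bij_betw (\<beta> \<circ> f \<circ> \<alpha>') (verts P') (verts Q')"
    using ba bb bf by (metis bij_betw_trans comp_assoc)
  then have 1: "bij_betw (conj_map (verts P') \<alpha>' \<beta> f) (verts P') (verts Q')"
    unfolding conj_map_def by (subst bij_betw_cong[where g = "\<beta> \<circ> f \<circ> \<alpha>'"]) auto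
  have 2: "strict_rel (le2 Q') (\<beta> (f (\<alpha>' i))) (\<beta> (f (\<alpha>' j)))"
    if "i \<in> verts P'" "j \<in> verts P'" "strict_rel (le1 P') i j" for i j
  proof -
    have "strict_rel (le1 P) (\<alpha>' i) (\<alpha>' j)" using strict_rel_iso(1)[OF a that(1,2)] that(3) by simp
    then have "strict_rel (le2 Q) (f (\<alpha>' i)) (f (\<alpha>' j))"
      using f am that by (auto simp: I_less_def)
    then show ?thesis using strict_rel_iso(2)[OF b fm fm] am that by blast
  qed
  show ?thesis using 1 2 by (auto simp: I_less_def conj_map_def)
qed

lemma dqp_lhd_cong:
  assumes "dqp_isomorphic P P'" "dqp_isomorphic Q Q'"
  shows "dqp_lhd P Q = (dqp_lhd P' Q' :: 'k::field hdqp)"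
proof -
  obtain \<alpha> \<beta> where a: "dqp_iso \<alpha> P P'" and b: "dqp_iso \<beta> Q Q'"
    using assms by (auto simp: dqp_isomorphic_def)
  have dq: "double_quasi_poset P" "double_quasi_poset P'"
    "double_quasi_poset Q" "double_quasi_poset Q'"
    using assms by (auto simp: dqp_isomorphic_def)
  define \<alpha>' where "\<alpha>' = inv_into (verts P) \<alpha>"
  define \<beta>' where "\<beta>' = inv_into (verts Q) \<beta>"
  have a': "dqp_iso \<alpha>' P' P" and b': "dqp_iso \<beta>' Q' Q"
    unfolding \<alpha>'_def \<beta>'_def using a b by (auto intro: dqp_iso_inv)
  have ba: "bij_betw \<alpha> (verts P) (verts P')" and bb: "bij_betw \<beta> (verts Q) (verts Q')"
    using a b by (auto simp: dqp_iso_def)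
  have inv: "\<alpha>' (\<alpha> i) = i" "\<alpha> i \<in> verts P'" if "i \<in> verts P" for i
    using ba that unfolding \<alpha>'_def by (auto simp: bij_betw_def)
  have inv': "\<alpha> (\<alpha>' i) = i" "\<alpha>' i \<in> verts P" if "i \<in> verts P'" for i
    using ba that unfolding \<alpha>'_def by (auto simp: bij_betw_def f_inv_into_f inv_into_into)
  have binv: "\<beta>' (\<beta> i) = i" if "i \<in> verts Q" for i
    using bb that unfolding \<beta>'_def by (auto simp: bij_betw_def)
  have binv': "\<beta> (\<beta>' i) = i" if "i \<in> verts Q'" for i
    using bb that unfolding \<beta>'_def by (auto simp: bij_betw_def f_inv_into_f)
  show ?thesis
    unfolding dqp_lhd_def
  proof (rule sum.reindex_bij_witness[where j = "conj_map (verts P') \<alpha>' \<beta>"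
        and i = "conj_map (verts P) \<alpha> \<beta>'"])
    fix f assume f: "f \<in> I_less P Q"
    have bf: "bij_betw f (verts P) (verts Q)" and ef: "f \<in> extensional (verts P)"
      using f by (auto simp: I_less_def)
    have fm: "f i \<in> verts Q" if "i \<in> verts P" for i
      using bf that by (auto simp: bij_betw_def)
    show "conj_map (verts P) \<alpha> \<beta>' (conj_map (verts P') \<alpha>' \<beta> f) = f"
      using ef by (auto simp: conj_map_def fun_eq_iff restrict_def inv binv fm extensional_def)
    show g: "conj_map (verts P') \<alpha>' \<beta> f \<in> I_less P' Q'"
      by (rule conj_map_I_less[OF a' b f])
    have "dqp_iso \<alpha> (twist P f Q) (twist P' (conj_map (verts P') \<alpha>' \<beta> f) Q')"
      using a b fm by (auto simp: dqp_iso_def twist_def conj_map_def inv)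
    moreover have "double_quasi_poset (twist P' (conj_map (verts P') \<alpha>' \<beta> f) Q')"
      using g dq by (intro double_quasi_poset_twist) (auto simp: I_less_def)
    moreover have "double_quasi_poset (twist P f Q)"
      using bf dq by (intro double_quasi_poset_twist) auto
    ultimately have "dqp_isomorphic (twist P f Q) (twist P' (conj_map (verts P') \<alpha>' \<beta> f) Q')"
      by (auto simp: dqp_isomorphic_def)
    then have "abs_dqp_class (twist P f Q) =
        abs_dqp_class (twist P' (conj_map (verts P') \<alpha>' \<beta> f) Q')"
      using Quotient_rel_abs[OF Quotient_dqp_class] by blast
    then show "dqp_vec (twist P' (conj_map (verts P') \<alpha>' \<beta> f) Q') =
        (dqp_vec (twist P f Q) :: 'k hdqp)"
      by (simp add: dqp_vec_def)
  next
    fix g assume g: "g \<in> I_less P' Q'"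
    have bg: "bij_betw g (verts P') (verts Q')" and eg: "g \<in> extensional (verts P')"
      using g by (auto simp: I_less_def)
    have gm: "g i \<in> verts Q'" if "i \<in> verts P'" for i
      using bg that by (auto simp: bij_betw_def)
    show "conj_map (verts P') \<alpha>' \<beta> (conj_map (verts P) \<alpha> \<beta>' g) = g"
      using eg by (auto simp: conj_map_def fun_eq_iff restrict_def inv' binv' gm extensional_def)
    show "conj_map (verts P) \<alpha> \<beta>' g \<in> I_less P Q"
      by (rule conj_map_I_less[OF a b' g])
  qed
qed

lift_definition class_lhd :: "dqp_class \<Rightarrow> dqp_class \<Rightarrow> 'k::field hdqp" is dqp_lhd
  by (rule dqp_lhd_cong)

definition lhd :: "'k::field hdqp \<Rightarrow> 'k hdqp \<Rightarrow> 'k hdqp"  (infixl "\<lhd>" 70) where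
  "x \<lhd> y = bilinear_ext class_lhd x y"


section \<open>Packed words and permutations\<close>

definition packed_words :: "nat \<Rightarrow> nat list set" where
  "packed_words n = {w. length w = n \<and> (\<exists>r. set w = {1..r})}"

text \<open>Letters are numbered from 1, list positions from 0.\<close>

definition letter :: "nat list \<Rightarrow> nat \<Rightarrow> nat" where
  "letter w i = w ! (i - 1)"

definition word_dqp :: "nat list \<Rightarrow> dqp" where
  "word_dqp w =
     DQP {1..length w}
       {(i, j) \<in> {1..length w} \<times> {1..length w}. letter w i \<le> letter w j}
       {(i, j) \<in> {1..length w} \<times> {1..length w}. i \<le> j}"

text \<open>
  Permutations act on \<open>{1..n}\<close> and fix everything else; \<open>perm_word\<close> writes one as a packed word.
\<close>

definition Sym :: "nat \<Rightarrow> (nat \<Rightarrow> nat) set" where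
  "Sym n = {\<sigma>. \<sigma> permutes {1..n}}"

definition perm_word :: "nat \<Rightarrow> (nat \<Rightarrow> nat) \<Rightarrow> nat list" where
  "perm_word n \<sigma> = map \<sigma> [1..<Suc n]"

definition Comp :: "nat list \<Rightarrow> (nat \<Rightarrow> nat) set" where
  "Comp w = {\<sigma> \<in> Sym (length w).
     \<forall>i\<in>{1..length w}. \<forall>j\<in>{1..length w}. letter w i < letter w j \<longrightarrow> \<sigma> i < \<sigma> j}"

definition KE :: "nat \<Rightarrow> 'k::field hdqp set" where
  "KE n = free_span ((\<lambda>w. dqp_vec (word_dqp w)) ` packed_words n)"

type_synonym 'k perm_space = "(nat \<Rightarrow> nat) \<Rightarrow>\<^sub>0 'k"

definition perm_vec :: "(nat \<Rightarrow> nat) \<Rightarrow> 'k::field perm_space" where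
  "perm_vec \<sigma> = Poly_Mapping.single \<sigma> 1"

definition KS :: "nat \<Rightarrow> 'k::field perm_space set" where
  "KS n = free_span (perm_vec ` Sym n)"

definition perm_mult :: "'k::field perm_space \<Rightarrow> 'k perm_space \<Rightarrow> 'k perm_space" where
  "perm_mult x y = bilinear_ext (\<lambda>\<sigma> \<tau>. perm_vec (\<sigma> \<circ> \<tau>)) x y"

text \<open>
  As \<open>w \<mapsto> P\<^sub>w\<close> is injective, the coefficient of \<open>P\<^sub>w\<close> in an element of \<open>KE n\<close> is its value at the
  class of \<open>P\<^sub>w\<close>. Only the values on \<open>KE n\<close>, respectively \<open>KS n\<close>, are meaningful.
\<close>

definition zeta :: "nat \<Rightarrow> 'k::field hdqp \<Rightarrow> 'k perm_space" where
  "zeta n x =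
     (\<Sum>w\<in>packed_words n. scale (Poly_Mapping.lookup x (abs_dqp_class (word_dqp w)))
        (\<Sum>\<sigma>\<in>Comp w. perm_vec (inv \<sigma>)))"

definition zeta' :: "nat \<Rightarrow> 'k::field perm_space \<Rightarrow> 'k hdqp" where
  "zeta' n x =
     (\<Sum>\<sigma>\<in>Sym n. scale (Poly_Mapping.lookup x \<sigma>)
        (dqp_vec (word_dqp (perm_word n (inv \<sigma>)))))"

end

theory Submission
  imports Defs
begin

text \<open>
  The bijections in \<open>I\<^sub><(P\<^sub>v, P\<^sub>w)\<close> are exactly the elements of \<open>Comp(v)\<close>, and
  \<open>P\<^sub>v \<times>\<^sub>\<sigma> P\<^sub>w = P\<^bsub>w\<circ>\<sigma>\<^esub>\<close>; hence \<open>P\<^sub>v \<lhd> P\<^sub>w\<close> is the sum of the \<open>P\<^bsub>w\<circ>\<sigma>\<^esub>\<close> over \<open>\<sigma> \<in> Comp(v)\<close>.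
  Since \<open>Comp(w \<circ> \<sigma>) = Comp(w) \<circ> \<sigma>\<close> and \<open>(\<rho> \<circ> \<sigma>)\<^sup>-\<^sup>1 = \<sigma>\<^sup>-\<^sup>1 \<circ> \<rho>\<^sup>-\<^sup>1\<close>, the map \<open>\<zeta>\<close> is multiplicative.
  For a permutation \<open>\<sigma>\<close> one has \<open>Comp(\<sigma>) = {\<sigma>}\<close>, which gives both the multiplicativity of \<open>\<zeta>'\<close>
  and \<open>\<zeta> \<circ> \<zeta>' = Id\<close>.
\<close>

section \<open>Linear and bilinear maps on free vector spaces\<close>

abbreviation free_linear :: "(('a \<Rightarrow>\<^sub>0 'k::field) \<Rightarrow> ('b \<Rightarrow>\<^sub>0 'k)) \<Rightarrow> bool" where
  "free_linear \<equiv> Vector_Spaces.linear scale scale"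

lemma free_linearI:
  assumes "\<And>x y. f (x + y) = f x + f y" "\<And>c x. f (scale c x) = scale c (f x)"
  shows "free_linear f"
  unfolding Vector_Spaces.linear_iff
  by (intro conjI allI free.vector_space_axioms assms)

lemma free_linear_add: "free_linear f \<Longrightarrow> f (x + y) = f x + f y"
  and free_linear_scale: "free_linear f \<Longrightarrow> f (scale c x) = scale c (f x)"
  by (simp_all add: Vector_Spaces.linear_iff)

lemma free_linear_zero: "free_linear f \<Longrightarrow> f 0 = 0"
  using free_linear_add[of f 0 0] by simp

lemma free_linear_sum: "free_linear f \<Longrightarrow> f (sum g A) = (\<Sum>a\<in>A. f (g a))"
  by (induction A rule: infinite_finite_induct) (simp_all add: free_linear_zero free_linear_add)

lemma free_linear_compose:
  assumes "free_linear f" "free_linear g"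
  shows "free_linear (\<lambda>x. f (g x))"
  using assms by (intro free_linearI) (simp_all add: free_linear_add free_linear_scale)

lemma free_linear_eq_on_span:
  assumes "free_linear f" "free_linear g" "\<And>b. b \<in> B \<Longrightarrow> f b = g b" "x \<in> free_span B"
  shows "f x = g x"
  using assms(4)
  by (induction rule: free.span_induct_alt)
    (simp_all add: assms(1-3) free_linear_add free_linear_scale free_linear_zero)

lemma free_linear_span_into:
  assumes "free_linear f" "\<And>b. b \<in> B \<Longrightarrow> f b \<in> free_span C" "x \<in> free_span B"
  shows "f x \<in> free_span C"
  using assms(3)
  by (induction rule: free.span_induct_alt)
    (simp_all add: assms(1,2) free_linear_add free_linear_scale free_linear_zero
      free.span_zero free.span_add free.span_scale)

text \<open>The common shape of \<open>zeta\<close> and \<open>zeta'\<close>: \<open>k b\<close> is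
  the basis element whose coordinate is read off, and coordinates depend linearly on the
  vector.\<close>

lemma free_linear_coordinates:
  "free_linear (\<lambda>x. \<Sum>b\<in>B. scale (Poly_Mapping.lookup x (k b)) (v b))"
  by (rule free_linearI)
    (simp_all add: lookup_add free.scale_left_distrib sum.distrib free.scale_sum_right)

text \<open>The added indices carry coefficient 0. Index sets that no longer depend on the supports
  make it possible to compare sums for vectors with different supports, such as \<open>x\<close>,
  \<open>x'\<close> and \<open>x + x'\<close>.\<close>

lemma bilinear_ext_supset:
  assumes "finite A" "finite B" "Poly_Mapping.keys x \<subseteq> A" "Poly_Mapping.keys y \<subseteq> B"
  shows "bilinear_ext g x y = (\<Sum>a\<in>A. \<Sum>b\<in>B.
    scale (Poly_Mapping.lookup x a * Poly_Mapping.lookup y b) (g a b))"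
proof -
  have "(\<Sum>b\<in>Poly_Mapping.keys y. scale (Poly_Mapping.lookup x a * Poly_Mapping.lookup y b) (g a b))
      = (\<Sum>b\<in>B. scale (Poly_Mapping.lookup x a * Poly_Mapping.lookup y b) (g a b))" for a
    using assms by (intro sum.mono_neutral_left) (auto simp: in_keys_iff)
  moreover have "(\<Sum>a\<in>Poly_Mapping.keys x. \<Sum>b\<in>B.
      scale (Poly_Mapping.lookup x a * Poly_Mapping.lookup y b) (g a b)) = (\<Sum>a\<in>A. \<Sum>b\<in>B.
      scale (Poly_Mapping.lookup x a * Poly_Mapping.lookup y b) (g a b))"
    using assms by (intro sum.mono_neutral_left) (auto simp: in_keys_iff)
  ultimately show ?thesis
    by (simp add: bilinear_ext_def)
qed

lemma keys_scale_subset: "Poly_Mapping.keys (scale c x) \<subseteq> Poly_Mapping.keys x"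
  by (auto simp: in_keys_iff)

lemma free_linear_bilinear_ext_left:
  fixes g :: "'a \<Rightarrow> 'b \<Rightarrow> 'c \<Rightarrow>\<^sub>0 'k::field"
  shows "free_linear (\<lambda>x. bilinear_ext g x y)"
proof (rule free_linearI)
  fix x x' :: "'a \<Rightarrow>\<^sub>0 'k" and c :: 'k
  let ?A = "Poly_Mapping.keys x \<union> Poly_Mapping.keys x'"
  note s = bilinear_ext_supset[where A = ?A and B = "Poly_Mapping.keys y" and y = y]
  have "Poly_Mapping.keys (x + x') \<subseteq> ?A"
    by (rule keys_add)
  then show "bilinear_ext g (x + x') y = bilinear_ext g x y + bilinear_ext g x' y"
    by (simp add: s lookup_add distrib_right free.scale_left_distrib sum.distrib)
  show "bilinear_ext g (scale c x) y = scale c (bilinear_ext g x y)"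
    using keys_scale_subset[of c x]
    by (subst (1 2) s) (auto simp: free.scale_sum_right mult.assoc)
qed

text \<open>Transfers linearity in the first argument to the second.\<close>

lemma bilinear_ext_swap: "bilinear_ext g x y = bilinear_ext (\<lambda>b a. g a b) y x"
  unfolding bilinear_ext_def by (subst sum.swap) (simp add: mult.commute)

lemma free_linear_bilinear_ext_right: "free_linear (bilinear_ext g x)"
  using free_linear_bilinear_ext_left by (subst ext[OF bilinear_ext_swap])

lemma bilinear_ext_single:
  "bilinear_ext g (Poly_Mapping.single a 1) (Poly_Mapping.single b 1) = g a b"
  by (simp add: bilinear_ext_def)

text \<open>All four conditions reduce to the spanning set \<open>B\<close>. For products, linearity
  is applied in each argument in turn: the right one with the left one fixed in \<open>B\<close>,
  then the left one with the right one arbitrary.\<close>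

lemma algebra_morphism_on_spanI:
  assumes f: "free_linear f"
    and into: "\<And>b. b \<in> B \<Longrightarrow> f b \<in> free_span C"
    and closed: "\<And>a b. a \<in> B \<Longrightarrow> b \<in> B \<Longrightarrow> bilinear_ext g a b \<in> free_span B"
    and mult: "\<And>a b. a \<in> B \<Longrightarrow> b \<in> B \<Longrightarrow> f (bilinear_ext g a b) = bilinear_ext h (f a) (f b)"
  shows "algebra_morphism_on (free_span B) (bilinear_ext g) (free_span C) (bilinear_ext h) f"
proof -
  have 1: "bilinear_ext g x y \<in> free_span B" if "x \<in> free_span B" "y \<in> free_span B" for x y
  proof (rule free_linear_span_into[OF free_linear_bilinear_ext_left _ that(1)])
    fix a assume "a \<in> B"
    then show "bilinear_ext g a y \<in> free_span B"
      using free_linear_span_into[OF free_linear_bilinear_ext_right _ that(2)] closed by blast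
  qed
  have 2: "f (bilinear_ext g x y) = bilinear_ext h (f x) (f y)"
    if "x \<in> free_span B" "y \<in> free_span B" for x y
  proof (rule free_linear_eq_on_span[OF _ _ _ that(1)])
    show "free_linear (\<lambda>x. f (bilinear_ext g x y))"
      by (rule free_linear_compose[OF f free_linear_bilinear_ext_left])
    show "free_linear (\<lambda>x. bilinear_ext h (f x) (f y))"
      by (rule free_linear_compose[OF free_linear_bilinear_ext_left f])
    fix a assume a: "a \<in> B"
    show "f (bilinear_ext g a y) = bilinear_ext h (f a) (f y)"
      by (rule free_linear_eq_on_span[OF _ _ _ that(2)])
        (auto intro: free_linear_compose f free_linear_bilinear_ext_right mult a)
  qed
  show ?thesis
    unfolding algebra_morphism_on_def
    using f 1 2 free_linear_span_into[OF f into]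
    by (auto simp: free_linear_add free_linear_scale)
qed


section \<open>Words as double quasi-posets\<close>

lemma letter_perm_word [simp]: "i \<in> {1..n} \<Longrightarrow> letter (perm_word n f) i = f i"
  by (auto simp add: letter_def perm_word_def simp del: upt_Suc)

lemma length_perm_word [simp]: "length (perm_word n f) = n"
  by (simp add: perm_word_def)

lemma set_perm_word [simp]: "set (perm_word n f) = f ` {1..n}"
  by (auto simp: perm_word_def)

lemma set_eq_letter_image: "set w = letter w ` {1..length w}"
proof -
  have "w ! i \<in> letter w ` {1..length w}" if "i < length w" for i
    \<comment> \<open>List position \<open>i\<close> is letter number \<open>Suc i\<close>.\<close>
    using that by (intro image_eqI[where x = "Suc i"]) (auto simp: letter_def)
  then show ?thesis
    by (auto simp: letter_def in_set_conv_nth intro!: nth_mem)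
qed

lemma word_eqI:
  assumes "length v = length w" "\<And>i. i \<in> {1..length w} \<Longrightarrow> letter v i = letter w i"
  shows "v = w"
proof (rule nth_equalityI)
  fix i assume "i < length v"
  then show "v ! i = w ! i"
    using assms(1) assms(2)[of "Suc i"] by (simp add: letter_def)
qed (fact assms(1))

lemma length_packed_words: "w \<in> packed_words n \<Longrightarrow> length w = n"
  by (simp add: packed_words_def)

text \<open>A word of length \<open>n\<close> has at most \<open>n\<close> distinct letters, so in a
  packed word every letter is at most \<open>n\<close>.\<close>

lemma finite_packed_words: "finite (packed_words n)"
proof (rule finite_subset)
  have "r \<le> length w" if "set w = {1..r}" for w :: "nat list" and r
    using card_length[of w] that by simp
  then show "packed_words n \<subseteq> {w. set w \<subseteq> {1..n} \<and> length w = n}"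
    by (fastforce simp: packed_words_def)
  show "finite {w. set w \<subseteq> {1..n} \<and> length w = n}"
    by (rule finite_lists_length_eq) simp
qed

lemma perm_word_packed:
  assumes "\<sigma> \<in> Sym n" shows "perm_word n \<sigma> \<in> packed_words n"
  using assms permutes_image[of \<sigma>] by (auto simp: packed_words_def Sym_def)

text \<open>\<open>perm_word\<close> lists the values of any function on \<open>{1..n}\<close>, so
  the word here is \<open>w\<close> with its positions permuted by \<open>\<sigma>\<close>; its set
  of letters is that of \<open>w\<close>.\<close>

lemma perm_word_letter_comp_packed:
  assumes "w \<in> packed_words n" "\<sigma> \<in> Sym n"
  shows "perm_word n (letter w \<circ> \<sigma>) \<in> packed_words n"
proof -
  have "(letter w \<circ> \<sigma>) ` {1..n} = set w"
    using assms permutes_image[of \<sigma> "{1..n}"]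
    unfolding image_comp[symmetric]
    by (simp add: Sym_def set_eq_letter_image length_packed_words)
  then show ?thesis
    using assms(1) by (simp add: packed_words_def)
qed

text \<open>A packed word is determined by the relative order of its letters, because its alphabet
  has no gaps. If the two letters at \<open>i\<close> differ, the smaller value also occurs in the
  word holding the larger one, at some position \<open>k\<close>. There \<open>v\<close> has a
  letter below \<open>letter v i\<close>, so the induction hypothesis makes both words agree at
  \<open>k\<close>, which contradicts the common order pattern.\<close>

lemma packed_words_letters_eqI:
  assumes v: "set v = {1..r}" and w: "set w = {1..s}" and len: "length v = length w"
    and le: "\<And>i j. i \<in> {1..length w} \<Longrightarrow> j \<in> {1..length w} \<Longrightarrow>
      letter v i \<le> letter v j \<longleftrightarrow> letter w i \<le> letter w j"
    and i: "i \<in> {1..length w}"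
  shows "letter v i = letter w i"
  using i
proof (induction "letter v i" arbitrary: i rule: less_induct)
  case less
  have pos: "letter w i \<in> {1..s}" "letter v i \<in> {1..r}"
    using less.prems v w len by (auto simp: set_eq_letter_image)
  show ?case
  proof (cases "letter v i" "letter w i" rule: linorder_cases)
    case less': less
    then have "letter v i \<in> letter w ` {1..length w}"
      using pos w unfolding set_eq_letter_image[symmetric] by simp
    then obtain k where k: "k \<in> {1..length w}" "letter w k = letter v i" by auto
    then have "letter v k < letter v i"
      using le[OF less.prems k(1)] less' by simp
    then show ?thesis
      using less.hyps[of k] k by simp
  next
    case greater
    then have "letter w i \<in> letter v ` {1..length w}"
      using pos v unfolding len[symmetric] set_eq_letter_image[symmetric] by simp
    then obtain k where k: "k \<in> {1..length w}" "letter v k = letter w i" by auto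
    then have "letter w k = letter w i"
      using less.hyps[of k] greater by simp
    then show ?thesis
      using le[OF less.prems k(1)] k greater by simp
  qed
qed

lemma verts_word_dqp [simp]: "verts (word_dqp w) = {1..length w}"
  by (simp add: word_dqp_def)

lemma double_quasi_poset_word_dqp: "double_quasi_poset (word_dqp w)"
  by (auto simp: double_quasi_poset_def word_dqp_def preorder_on_def refl_on_def trans_def)

lemma strict_rel_le1_word_dqp:
  "strict_rel (le1 (word_dqp w)) i j \<longleftrightarrow>
     i \<in> {1..length w} \<and> j \<in> {1..length w} \<and> letter w i < letter w j"
  by (auto simp: strict_rel_def equiv_rel_def word_dqp_def)

lemma strict_rel_le2_word_dqp:
  "strict_rel (le2 (word_dqp w)) i j \<longleftrightarrow> i \<in> {1..length w} \<and> j \<in> {1..length w} \<and> i < j"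
  by (auto simp: strict_rel_def equiv_rel_def word_dqp_def)

text \<open>Rigidity of a finite chain. It is used twice: for isomorphisms between the double
  quasi-posets of words, and for permutations compatible with a permutation.\<close>

lemma bij_betw_mono_interval_id:
  fixes f :: "nat \<Rightarrow> nat"
  assumes b: "bij_betw f {1..n} {1..n}"
    and m: "\<And>i j. i \<in> {1..n} \<Longrightarrow> j \<in> {1..n} \<Longrightarrow> i < j \<Longrightarrow> f i < f j"
    and i: "i \<in> {1..n}"
  shows "f i = i"
  using i
proof (induction i rule: less_induct)
  case (less i)
  have fi: "f i \<in> {1..n}" using b less.prems by (auto simp: bij_betw_def)
  \<comment> \<open>Otherwise \<open>f (f i) = f i\<close> by induction, against
    injectivity.\<close>
  have "\<not> f i < i"
    using less.IH[of "f i"] fi inj_onD[OF bij_betw_imp_inj_on[OF b], of "f i" i] less.prems by auto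
  moreover have "\<not> i < f i"
  proof
    assume lt: "i < f i"
    \<comment> \<open>The preimage \<open>k\<close> of \<open>i\<close> has nowhere to lie: below
      \<open>i\<close> the map is already the identity, \<open>k = i\<close> contradicts
      \<open>i < f i\<close>, and \<open>i < k\<close> would give \<open>f i < i\<close>.\<close>
    obtain k where k: "k \<in> {1..n}" "f k = i"
      using b less.prems by (metis bij_betw_def imageE)
    show False
      using less.IH[of k] m[of i k] k lt less.prems by (cases k i rule: linorder_cases) auto
  qed
  ultimately show ?case by simp
qed

text \<open>The second preorder is the usual order, so an isomorphism is increasing and hence the
  identity; the first preorders then coincide and determine the packed word. This is what allows
  \<open>zeta\<close> to read off coefficients at isomorphism classes.\<close>

lemma word_dqp_class_inj:
  "inj_on (\<lambda>w. abs_dqp_class (word_dqp w)) (packed_words n)"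
proof (rule inj_onI)
  fix v w assume v: "v \<in> packed_words n" and w: "w \<in> packed_words n"
    and eq: "abs_dqp_class (word_dqp v) = abs_dqp_class (word_dqp w)"
  note len = length_packed_words[OF v] length_packed_words[OF w]
  \<comment> \<open>The quotient is partial: equal classes yield isomorphic representatives only
    once both representatives are known to be related to themselves.\<close>
  have "dqp_isomorphic P P" if "double_quasi_poset P" for P
    using that dqp_iso_id by (auto simp: dqp_isomorphic_def)
  then have "dqp_isomorphic (word_dqp v) (word_dqp w)"
    using eq double_quasi_poset_word_dqp
    by (subst Quotient_rel[OF Quotient_dqp_class, symmetric]) simp
  then obtain \<alpha> where \<alpha>: "dqp_iso \<alpha> (word_dqp v) (word_dqp w)"
    by (auto simp: dqp_isomorphic_def)
  then have b: "bij_betw \<alpha> {1..n} {1..n}"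
    by (simp add: dqp_iso_def len)
  have "\<alpha> i < \<alpha> j" if "i \<in> {1..n}" "j \<in> {1..n}" "i < j" for i j
    using strict_rel_iso(2)[OF \<alpha>, of i j] that by (simp add: strict_rel_le2_word_dqp len)
  then have id: "\<alpha> i = i" if "i \<in> {1..n}" for i
    using bij_betw_mono_interval_id[OF b] that by blast
  have le: "letter v i \<le> letter v j \<longleftrightarrow> letter w i \<le> letter w j"
    if "i \<in> {1..n}" "j \<in> {1..n}" for i j
    using \<alpha> that by (simp add: dqp_iso_def word_dqp_def len id)
  obtain r s where sets: "set v = {1..r}" "set w = {1..s}"
    using v w by (auto simp: packed_words_def)
  show "v = w"
  proof (rule word_eqI)
    show "length v = length w" by (simp add: len)
    then show "letter v i = letter w i" if "i \<in> {1..length w}" for i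
      using le that unfolding len by (intro packed_words_letters_eqI[OF sets]) (simp_all only: len)
  qed
qed


section \<open>Compatible permutations and the product of words\<close>

lemma Sym_bij: "\<sigma> \<in> Sym n \<Longrightarrow> bij \<sigma>"
  by (auto simp: Sym_def permutes_bij)

lemma Sym_in_interval: "\<sigma> \<in> Sym n \<Longrightarrow> \<sigma> i \<in> {1..n} \<longleftrightarrow> i \<in> {1..n}"
  unfolding Sym_def by (simp only: mem_Collect_eq permutes_in_image)

lemma Sym_comp: "\<sigma> \<in> Sym n \<Longrightarrow> \<tau> \<in> Sym n \<Longrightarrow> \<sigma> \<circ> \<tau> \<in> Sym n"
  by (auto simp: Sym_def permutes_compose)

lemma Sym_inv: "\<sigma> \<in> Sym n \<Longrightarrow> inv \<sigma> \<in> Sym n"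
  by (auto simp: Sym_def permutes_inv)

lemma Comp_subset_Sym: "Comp w \<subseteq> Sym (length w)"
  by (auto simp: Comp_def)

lemma finite_Sym: "finite (Sym n)"
  by (simp add: Sym_def finite_permutations)

text \<open>For \<open>\<tau>\<close> compatible with \<open>\<sigma>\<close>, the permutation
  \<open>\<tau> \<circ> inv \<sigma>\<close> is increasing on \<open>{1..n}\<close>, hence the
  identity.\<close>

lemma Comp_perm_word:
  assumes "\<sigma> \<in> Sym n"
  shows "Comp (perm_word n \<sigma>) = {\<sigma>}"
proof (intro equalityI subsetI; clarsimp)
  show "\<sigma> \<in> Comp (perm_word n \<sigma>)"
    using assms by (simp add: Comp_def)
  fix \<tau> assume t: "\<tau> \<in> Comp (perm_word n \<sigma>)"
  then have T: "\<tau> \<in> Sym n"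
    and mono: "\<And>i j. i \<in> {1..n} \<Longrightarrow> j \<in> {1..n} \<Longrightarrow> \<sigma> i < \<sigma> j \<Longrightarrow> \<tau> i < \<tau> j"
    by (auto simp: Comp_def)
  let ?\<rho> = "\<tau> \<circ> inv \<sigma>"
  have R: "?\<rho> permutes {1..n}"
    using Sym_comp[OF T Sym_inv[OF assms]] by (simp add: Sym_def)
  have inv: "\<sigma> (inv \<sigma> i) = i" for i
    using Sym_bij[OF assms] by (simp add: bij_def surj_f_inv_f)
  have "?\<rho> i = i" if "i \<in> {1..n}" for i
  proof (rule bij_betw_mono_interval_id[OF permutes_imp_bij[OF R] _ that])
    fix i j assume "i \<in> {1..n}" "j \<in> {1..n}" "i < j"
    then show "?\<rho> i < ?\<rho> j"
      using mono[of "inv \<sigma> i" "inv \<sigma> j"] Sym_in_interval[OF Sym_inv[OF assms]]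
      by (simp only: inv comp_apply)
  qed
  then have "?\<rho> = id"
    using R by (metis eq_id_iff permutes_not_in)
  then show "\<tau> = \<sigma>"
    using Sym_bij[OF assms] by (metis bij_is_inj comp_assoc comp_id id_comp inv_o_cancel)
qed

text \<open>Renaming positions by \<open>\<sigma>\<close> turns compatibility of
  \<open>\<tau>\<close> with the permuted word into compatibility of
  \<open>\<tau> \<circ> inv \<sigma>\<close> with \<open>w\<close>.\<close>

lemma Comp_perm_word_letter_comp:
  assumes "length w = n" and s: "\<sigma> \<in> Sym n"
  shows "Comp (perm_word n (letter w \<circ> \<sigma>)) = (\<lambda>\<rho>. \<rho> \<circ> \<sigma>) ` Comp w"
proof (intro equalityI subsetI)
  fix \<tau> assume "\<tau> \<in> Comp (perm_word n (letter w \<circ> \<sigma>))"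
  then have T: "\<tau> \<in> Sym n" and mono: "\<And>i j. i \<in> {1..n} \<Longrightarrow> j \<in> {1..n} \<Longrightarrow>
      letter w (\<sigma> i) < letter w (\<sigma> j) \<Longrightarrow> \<tau> i < \<tau> j"
    by (auto simp: Comp_def)
  have inv: "\<sigma> (inv \<sigma> i) = i" for i
    using Sym_bij[OF s] by (simp add: bij_def surj_f_inv_f)
  have "(\<tau> \<circ> inv \<sigma>) i < (\<tau> \<circ> inv \<sigma>) j"
    if "i \<in> {1..n}" "j \<in> {1..n}" "letter w i < letter w j" for i j
    using mono[of "inv \<sigma> i" "inv \<sigma> j"] Sym_in_interval[OF Sym_inv[OF s]] that
    by (simp only: inv comp_apply)
  then have "\<tau> \<circ> inv \<sigma> \<in> Comp w"
    using Sym_comp[OF T Sym_inv[OF s]] assms(1) by (simp add: Comp_def)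
  moreover have "\<tau> = (\<tau> \<circ> inv \<sigma>) \<circ> \<sigma>"
    using Sym_bij[OF s] by (simp add: comp_assoc bij_is_inj)
  ultimately show "\<tau> \<in> (\<lambda>\<rho>. \<rho> \<circ> \<sigma>) ` Comp w" by blast
next
  fix \<tau> assume "\<tau> \<in> (\<lambda>\<rho>. \<rho> \<circ> \<sigma>) ` Comp w"
  then obtain \<rho> where \<tau>: "\<tau> = \<rho> \<circ> \<sigma>" and R: "\<rho> \<in> Sym n"
    and mono: "\<And>i j. i \<in> {1..n} \<Longrightarrow> j \<in> {1..n} \<Longrightarrow> letter w i < letter w j \<Longrightarrow> \<rho> i < \<rho> j"
    using assms(1) by (auto simp: Comp_def)
  have "\<tau> i < \<tau> j" if "i \<in> {1..n}" "j \<in> {1..n}" "letter w (\<sigma> i) < letter w (\<sigma> j)" for i j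
    using mono[of "\<sigma> i" "\<sigma> j"] Sym_in_interval[OF s] that by (simp only: \<tau> comp_apply)
  then show "\<tau> \<in> Comp (perm_word n (letter w \<circ> \<sigma>))"
    using Sym_comp[OF R s] by (simp add: Comp_def \<tau>)
qed

text \<open>The strict first order of \<open>word_dqp v\<close> compares letters and the strict
  second order of \<open>word_dqp w\<close> is \<open><\<close> on positions, which is the condition
  in \<open>Comp v\<close>. The \<open>restrict\<close> reconciles two conventions outside
  \<open>{1..n}\<close>: elements of \<open>I_less\<close> are undefined there, permutations are the
  identity.\<close>

lemma I_less_word_dqp:
  assumes "length v = n" "length w = n"
  shows "I_less (word_dqp v) (word_dqp w) = (\<lambda>\<sigma>. restrict \<sigma> {1..n}) ` Comp v"
proof (intro equalityI subsetI)
  fix f assume f: "f \<in> I_less (word_dqp v) (word_dqp w)"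
  \<comment> \<open>The only extension of \<open>f\<close> that fixes everything outside the
    interval.\<close>
  let ?\<sigma> = "\<lambda>i. if i \<in> {1..n} then f i else i"
  have b: "bij_betw f {1..n} {1..n}" and e: "f \<in> extensional {1..n}"
    using f assms by (auto simp: I_less_def)
  have "bij_betw ?\<sigma> {1..n} {1..n}"
    using b by (subst bij_betw_cong[where g = f]) auto
  then have "?\<sigma> permutes {1..n}"
    by (rule bij_imp_permutes) auto
  then have "?\<sigma> \<in> Comp v"
    using f assms
    by (auto simp: Comp_def Sym_def I_less_def strict_rel_le1_word_dqp strict_rel_le2_word_dqp)
  moreover have "f = restrict ?\<sigma> {1..n}"
    using e by (auto simp: fun_eq_iff restrict_def extensional_def)
  ultimately show "f \<in> (\<lambda>\<sigma>. restrict \<sigma> {1..n}) ` Comp v" by blast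
next
  fix f assume "f \<in> (\<lambda>\<sigma>. restrict \<sigma> {1..n}) ` Comp v"
  then obtain \<sigma> where f: "f = restrict \<sigma> {1..n}" and s: "\<sigma> \<in> Comp v" by auto
  have S: "\<sigma> \<in> Sym n" using s Comp_subset_Sym assms by auto
  have "bij_betw f {1..n} {1..n}"
    unfolding f using S by (subst bij_betw_cong[where g = \<sigma>]) (auto simp: Sym_def permutes_imp_bij)
  then show "f \<in> I_less (word_dqp v) (word_dqp w)"
    using s assms Sym_in_interval[OF S]
    by (auto simp: I_less_def Comp_def f strict_rel_le1_word_dqp strict_rel_le2_word_dqp)
qed

text \<open>The second preorder is the usual order on positions for every word and the first is
  pulled back along \<open>\<sigma>\<close>, so the twist is again the double quasi-poset of a word.
  Hence the span of the words is stable under the product.\<close>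

lemma twist_word_dqp:
  assumes "length v = n" "length w = n" "\<sigma> \<in> Sym n"
  shows "twist (word_dqp v) (restrict \<sigma> {1..n}) (word_dqp w)
    = word_dqp (perm_word n (letter w \<circ> \<sigma>))" (is "?P = ?Q")
proof (rule dqp.expand, intro conjI)
  have "(i, j) \<in> le1 ?P \<longleftrightarrow> (i, j) \<in> le1 ?Q" for i j
  proof (cases "i \<in> {1..n} \<and> j \<in> {1..n}")
    case True
    then have "\<sigma> i \<in> {1..n}" "\<sigma> j \<in> {1..n}"
      using Sym_in_interval[OF assms(3)] by simp_all
    then show ?thesis
      using True assms(1,2) by (simp add: twist_def word_dqp_def del: atLeastAtMost_iff)
  next
    case False
    then show ?thesis
      using assms(1,2) by (auto simp: twist_def word_dqp_def)
  qed
  then show "le1 ?P = le1 ?Q" by (intro set_eqI) (simp only: split_paired_all)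
qed (simp_all add: twist_def word_dqp_def assms(1,2))

lemma lhd_word_dqp:
  assumes "length v = n" "length w = n"
  shows "dqp_vec (word_dqp v) \<lhd> dqp_vec (word_dqp w) =
    (\<Sum>\<sigma>\<in>Comp v. dqp_vec (word_dqp (perm_word n (letter w \<circ> \<sigma>))) :: 'k::field hdqp)"
proof -
  have "dqp_isomorphic (word_dqp u) (word_dqp u)" for u
    using dqp_iso_id double_quasi_poset_word_dqp by (auto simp: dqp_isomorphic_def)
  then have "dqp_vec (word_dqp v) \<lhd> dqp_vec (word_dqp w) =
      (dqp_lhd (word_dqp v) (word_dqp w) :: 'k hdqp)"
    by (simp add: lhd_def dqp_vec_def bilinear_ext_single class_lhd.abs_eq)
  also have "\<dots> = (\<Sum>f\<in>(\<lambda>\<sigma>. restrict \<sigma> {1..n}) ` Comp v.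
      dqp_vec (twist (word_dqp v) f (word_dqp w)))"
    by (simp only: dqp_lhd_def I_less_word_dqp[OF assms])
  also have "\<dots> = (\<Sum>\<sigma>\<in>Comp v. dqp_vec (twist (word_dqp v) (restrict \<sigma> {1..n}) (word_dqp w)))"
  proof (subst sum.reindex)
    \<comment> \<open>Restriction loses nothing, since permutations of \<open>{1..n}\<close> all
      agree outside it.\<close>
    show "inj_on (\<lambda>\<sigma>. restrict \<sigma> {1..n}) (Comp v)"
    proof (rule inj_onI)
      fix \<sigma> \<tau> assume "\<sigma> \<in> Comp v" "\<tau> \<in> Comp v"
        and eq: "restrict \<sigma> {1..n} = restrict \<tau> {1..n}"
      then have "\<sigma> permutes {1..n}" "\<tau> permutes {1..n}"
        using Comp_subset_Sym assms by (auto simp: Sym_def)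
      then show "\<sigma> = \<tau>"
        using eq by (metis ext permutes_not_in restrict_apply')
    qed
  qed simp
  also have "\<dots> = (\<Sum>\<sigma>\<in>Comp v. dqp_vec (word_dqp (perm_word n (letter w \<circ> \<sigma>))))"
    using Comp_subset_Sym[of v] twist_word_dqp[OF assms] assms by (intro sum.cong) auto
  finally show ?thesis .
qed

lemma perm_mult_perm_vec: "perm_mult (perm_vec \<sigma>) (perm_vec \<tau>) = perm_vec (\<sigma> \<circ> \<tau>)"
  by (simp add: perm_mult_def perm_vec_def bilinear_ext_single)


section \<open>The two morphisms\<close>

lemma free_linear_zeta: "free_linear (zeta n)"
  unfolding zeta_def by (rule free_linear_coordinates)

lemma free_linear_zeta': "free_linear (zeta' n)"
  unfolding zeta'_def by (rule free_linear_coordinates)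

text \<open>By injectivity of the map from packed words to classes, only the summand of
  \<open>w\<close> itself has a nonzero coefficient.\<close>

lemma zeta_word:
  assumes "w \<in> packed_words n"
  shows "zeta n (dqp_vec (word_dqp w)) = (\<Sum>\<sigma>\<in>Comp w. perm_vec (inv \<sigma>))"
proof -
  have "zeta n (dqp_vec (word_dqp w)) =
      (\<Sum>v\<in>packed_words n. if v = w then \<Sum>\<sigma>\<in>Comp v. perm_vec (inv \<sigma>) else 0)"
    unfolding zeta_def
    using inj_onD[OF word_dqp_class_inj _ _ assms] assms
    by (intro sum.cong) (auto simp: dqp_vec_def lookup_single when_def)
  then show ?thesis
    using assms by (simp add: finite_packed_words)
qed

lemma zeta'_perm:
  assumes "\<sigma> \<in> Sym n"
  shows "zeta' n (perm_vec \<sigma>) = dqp_vec (word_dqp (perm_word n (inv \<sigma>)))"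
proof -
  have "zeta' n (perm_vec \<sigma>) =
      (\<Sum>\<tau>\<in>Sym n. if \<tau> = \<sigma> then dqp_vec (word_dqp (perm_word n (inv \<tau>))) else 0)"
    unfolding zeta'_def by (intro sum.cong) (auto simp: perm_vec_def lookup_single when_def)
  then show ?thesis
    using assms by (simp add: finite_Sym)
qed

text \<open>Both sides equal the sum of \<open>inv \<sigma> \<circ> inv \<rho>\<close> over
  \<open>\<sigma>\<close> in \<open>Comp v\<close> and \<open>\<rho>\<close> in
  \<open>Comp w\<close>. Permuting \<open>w\<close> by \<open>\<sigma>\<close> puts
  \<open>\<sigma>\<close> on the right of \<open>\<rho>\<close>; inversion moves it to the left,
  where the product in the group algebra has it.\<close>

lemma zeta_lhd_word:
  assumes v: "v \<in> packed_words n" and w: "w \<in> packed_words n"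
  shows "zeta n (dqp_vec (word_dqp v) \<lhd> dqp_vec (word_dqp w)) =
    perm_mult (zeta n (dqp_vec (word_dqp v))) (zeta n (dqp_vec (word_dqp w)))"
proof -
  note len = length_packed_words[OF v] length_packed_words[OF w]
  have S: "\<sigma> \<in> Sym n" if "\<sigma> \<in> Comp v \<union> Comp w" for \<sigma>
    using that Comp_subset_Sym[of v] Comp_subset_Sym[of w] len by auto
  have "zeta n (dqp_vec (word_dqp v) \<lhd> dqp_vec (word_dqp w)) =
      (\<Sum>\<sigma>\<in>Comp v. \<Sum>\<tau>\<in>(\<lambda>\<rho>. \<rho> \<circ> \<sigma>) ` Comp w. perm_vec (inv \<tau>))"
    using S perm_word_letter_comp_packed[OF w]
    by (simp add: lhd_word_dqp[OF len] free_linear_sum[OF free_linear_zeta] zeta_word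
      Comp_perm_word_letter_comp[OF len(2)])
  also have "\<dots> = (\<Sum>\<sigma>\<in>Comp v. \<Sum>\<rho>\<in>Comp w. perm_vec (inv \<sigma> \<circ> inv \<rho>))"
  proof (rule sum.cong[OF refl])
    fix \<sigma> assume "\<sigma> \<in> Comp v"
    then have b: "bij \<sigma>" using S Sym_bij by blast
    \<comment> \<open>A surjective \<open>\<sigma>\<close> can be cancelled on the right.\<close>
    have "inj_on (\<lambda>\<rho>. \<rho> \<circ> \<sigma>) (Comp w)"
      using b by (intro inj_onI) (metis bij_is_surj fun.inj_map_strong surj_fun_eq)
    moreover have "inv (\<rho> \<circ> \<sigma>) = inv \<sigma> \<circ> inv \<rho>" if "\<rho> \<in> Comp w" for \<rho>
      using that S Sym_bij b by (intro o_inv_distrib) blast+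
    ultimately show "(\<Sum>\<tau>\<in>(\<lambda>\<rho>. \<rho> \<circ> \<sigma>) ` Comp w. perm_vec (inv \<tau>)) =
        (\<Sum>\<rho>\<in>Comp w. perm_vec (inv \<sigma> \<circ> inv \<rho>))"
      by (simp add: sum.reindex)
  qed
  also have "\<dots> = perm_mult (\<Sum>\<sigma>\<in>Comp v. perm_vec (inv \<sigma>)) (\<Sum>\<rho>\<in>Comp w. perm_vec (inv \<rho>))"
    unfolding perm_mult_perm_vec[symmetric]
    unfolding perm_mult_def
    unfolding free_linear_sum[OF free_linear_bilinear_ext_left]
    unfolding free_linear_sum[OF free_linear_bilinear_ext_right] ..
  finally show ?thesis
    by (simp add: zeta_word v w)
qed

lemma algebra_morphism_zeta:
  "algebra_morphism_on (KE n :: 'k::field hdqp set) (\<lhd>) (KS n) perm_mult (zeta n)"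
proof -
  let ?P = "\<lambda>w. dqp_vec (word_dqp w) :: 'k hdqp"
  have in_KE: "?P w \<in> free_span (?P ` packed_words n)" if "w \<in> packed_words n" for w
    using that by (intro free.span_base) simp
  have "zeta n (?P w) \<in> free_span (perm_vec ` Sym n)" if "w \<in> packed_words n" for w
    unfolding zeta_word[OF that]
    using Comp_subset_Sym[of w] Sym_inv length_packed_words[OF that]
    by (intro free.span_sum free.span_base) blast
  moreover have "?P v \<lhd> ?P w \<in> free_span (?P ` packed_words n)"
    if "v \<in> packed_words n" "w \<in> packed_words n" for v w
    unfolding lhd_word_dqp[OF that[THEN length_packed_words]]
    using that Comp_subset_Sym[of v] length_packed_words[OF that(1)]
    by (intro free.span_sum in_KE perm_word_letter_comp_packed) blast+
  ultimately have "algebra_morphism_on (KE n :: 'k hdqp set) (bilinear_ext class_lhd) (KS n)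
      (bilinear_ext (\<lambda>\<sigma> \<tau>. perm_vec (\<sigma> \<circ> \<tau>))) (zeta n)"
    unfolding KE_def KS_def
    using zeta_lhd_word[where ?'a = 'k]
    by (intro algebra_morphism_on_spanI free_linear_zeta) (auto simp: lhd_def perm_mult_def)
  then show ?thesis
    by (simp add: lhd_def perm_mult_def algebra_morphism_on_def)
qed

text \<open>The word of \<open>inv \<sigma>\<close> has \<open>inv \<sigma>\<close> as its only
  compatible permutation, so the product on the right has a single term, the word of
  \<open>inv \<tau> \<circ> inv \<sigma>\<close>, and this is the inverse of
  \<open>\<sigma> \<circ> \<tau>\<close>.\<close>

lemma zeta'_perm_mult:
  assumes "\<sigma> \<in> Sym n" "\<tau> \<in> Sym n"
  shows "zeta' n (perm_mult (perm_vec \<sigma>) (perm_vec \<tau>)) =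
    zeta' n (perm_vec \<sigma>) \<lhd> zeta' n (perm_vec \<tau>)"
proof -
  \<comment> \<open>The letters of \<open>perm_word n (inv \<tau>)\<close> give back
    \<open>inv \<tau>\<close> on \<open>{1..n}\<close>, and \<open>inv \<sigma>\<close> maps this
    interval to itself.\<close>
  have "perm_word n (letter (perm_word n (inv \<tau>)) \<circ> inv \<sigma>) = perm_word n (inv \<tau> \<circ> inv \<sigma>)"
    using Sym_in_interval[OF Sym_inv[OF assms(1)]] by (intro word_eqI) simp_all
  then show ?thesis
    using assms Sym_comp[OF assms]
    by (simp add: perm_mult_perm_vec zeta'_perm lhd_word_dqp[of _ n] Comp_perm_word Sym_inv
      o_inv_distrib Sym_bij)
qed

lemma algebra_morphism_zeta':
  "algebra_morphism_on (KS n :: 'k::field perm_space set) perm_mult (KE n) (\<lhd>) (zeta' n)"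
proof -
  have "zeta' n (perm_vec \<sigma>) \<in> free_span ((\<lambda>w. dqp_vec (word_dqp w) :: 'k hdqp) ` packed_words n)"
    if "\<sigma> \<in> Sym n" for \<sigma>
    using that by (auto simp: zeta'_perm intro!: free.span_base perm_word_packed Sym_inv)
  moreover have "perm_mult (perm_vec \<sigma>) (perm_vec \<tau>) \<in>
      free_span ((perm_vec :: _ \<Rightarrow> 'k perm_space) ` Sym n)"
    if "\<sigma> \<in> Sym n" "\<tau> \<in> Sym n" for \<sigma> \<tau>
    using that by (auto simp: perm_mult_perm_vec intro!: free.span_base Sym_comp)
  ultimately have "algebra_morphism_on (KS n :: 'k perm_space set)
      (bilinear_ext (\<lambda>\<sigma> \<tau>. perm_vec (\<sigma> \<circ> \<tau>))) (KE n) (bilinear_ext class_lhd) (zeta' n)"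
    unfolding KE_def KS_def
    using zeta'_perm_mult[where ?'a = 'k]
    by (intro algebra_morphism_on_spanI free_linear_zeta') (auto simp: lhd_def perm_mult_def)
  then show ?thesis
    by (simp add: lhd_def perm_mult_def algebra_morphism_on_def)
qed

text \<open>On a basis vector the sum defining \<open>zeta\<close> runs over the single permutation
  \<open>inv \<sigma>\<close>, whose inverse is \<open>\<sigma>\<close>; linearity does the
  rest.\<close>

lemma zeta_zeta':
  assumes "x \<in> KS n"
  shows "zeta n (zeta' n x) = x"
proof (rule free_linear_eq_on_span[where g = "\<lambda>x. x"])
  show "x \<in> free_span (perm_vec ` Sym n)"
    using assms by (simp add: KS_def)
  show "zeta n (zeta' n b) = b" if "b \<in> perm_vec ` Sym n" for b
    using that
    by (auto simp: zeta'_perm zeta_word perm_word_packed Comp_perm_word Sym_inv inv_inv_eq Sym_bij)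
qed (auto intro: free_linear_compose free_linear_zeta free_linear_zeta' free_linearI)

text \<open>The conjuncts on basis vectors confirm that the maps, defined through coordinates, take
  the prescribed values there; the others give the two morphisms and the section property.\<close>

theorem proposition33:
  fixes n :: nat
  assumes "n \<ge> 1"
  shows
    "(\<forall>w\<in>packed_words n.
        zeta n (dqp_vec (word_dqp w) :: 'k::field hdqp) = (\<Sum>\<sigma>\<in>Comp w. perm_vec (inv \<sigma>))) \<and>
     algebra_morphism_on (KE n :: 'k hdqp set) (\<lhd>) (KS n) perm_mult (zeta n) \<and>
     (\<forall>\<sigma>\<in>Sym n.
        zeta' n (perm_vec \<sigma> :: 'k perm_space) = dqp_vec (word_dqp (perm_word n (inv \<sigma>)))) \<and>
     algebra_morphism_on (KS n :: 'k perm_space set) perm_mult (KE n) (\<lhd>) (zeta' n) \<and>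
     (\<forall>x\<in>(KS n :: 'k perm_space set). zeta n (zeta' n x) = x)"
  by (simp add: zeta_word zeta'_perm algebra_morphism_zeta algebra_morphism_zeta' zeta_zeta')

end
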